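(* The class of $(P_6,\overline{2P_1+P_2})$-free graphs has unbounded clique-width.
   Context: All graphs are finite, simple and undirected. For a family of graphs $\{H_1,\ldots,H_p\}$, a graph $G$ is $(H_1,\ldots,H_p)$-free if no induced subgraph of $G$ is isomorphic to any $H_i$. $P_r$ denotes the path on $r$ vertices; $G+H$ is the disjoint union of $G$ and $H$, $sG$ is the disjoint union of $s$ copies of $G$; $\overline{G}$ denotes the complement of $G$ (so $\overline{2P_1+P_2}$ is the diamond, $K_4$ minus an edge). The clique-width of a graph $G$ is the minimum number of labels needed to construct $G$ using the operations: create a single vertex with label $i$; take the disjoint union of two labelled graphs; add all edges between vertices labelled $i$ and vertices labelled $j$ ($i\neq j$); rename label $i$ to $j$. A class of graphs has bounded clique-width if there is a constant $c$ such that every graph in the class has clique-width at most $c$, and unbounded clique-width otherwise. *)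

theory Defs
  imports "Graph_Theory.Graph_Theory"
begin

text \<open>
  Following Graph_Theory, a finite simple undirected graph is a \<^locale>\<open>pair_graph\<close>: a finite
  loop-free digraph with a symmetric arc relation, an undirected edge \<open>uv\<close> being the two arcs
  \<open>(u,v)\<close> and \<open>(v,u)\<close>.
\<close>

section \<open>Forbidden induced subgraphs\<close>

definition path_graph :: "nat \<Rightarrow> nat pair_pre_digraph" (\<open>P\<^bsub>_\<^esub>\<close>) where
  "P\<^bsub>r\<^esub> = \<lparr> pverts = {..<r}, parcs = {(u, v). u < r \<and> v < r \<and> (v = Suc u \<or> u = Suc v)} \<rparr>"

definition disjoint_sum ::
  "'a pair_pre_digraph \<Rightarrow> 'b pair_pre_digraph \<Rightarrow> ('a + 'b) pair_pre_digraph" (infixl \<open>\<oplus>\<^sub>G\<close> 65) where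
  "G \<oplus>\<^sub>G H = \<lparr> pverts = pverts G <+> pverts H,
     parcs = {(Inl u, Inl v) |u v. (u, v) \<in> parcs G} \<union> {(Inr u, Inr v) |u v. (u, v) \<in> parcs H} \<rparr>"

definition graph_copies ::
  "nat \<Rightarrow> 'a pair_pre_digraph \<Rightarrow> (nat \<times> 'a) pair_pre_digraph" (infixr \<open>\<cdot>\<^sub>G\<close> 70) where
  "s \<cdot>\<^sub>G G = \<lparr> pverts = {..<s} \<times> pverts G,
     parcs = {((i, u), (i, v)) |i u v. i < s \<and> (u, v) \<in> parcs G} \<rparr>"

definition complement_graph :: "'a pair_pre_digraph \<Rightarrow> 'a pair_pre_digraph" where
  "complement_graph G = \<lparr> pverts = pverts G,
     parcs = {(u, v). u \<in> pverts G \<and> v \<in> pverts G \<and> u \<noteq> v \<and> (u, v) \<notin> parcs G} \<rparr>"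

definition induced_free :: "'b pair_pre_digraph \<Rightarrow> 'a pair_pre_digraph \<Rightarrow> bool" where
  "induced_free H G \<longleftrightarrow>
     \<not> (\<exists>K :: 'a pair_pre_digraph.
          induced_subgraph (with_proj K) (with_proj G) \<and> digraph_iso (with_proj K) (with_proj H))"

section \<open>Clique-width\<close>

datatype 'a cw_expr =
    Vertex 'a nat
  | Disj_Union "'a cw_expr" "'a cw_expr"
  | Join nat nat "'a cw_expr"
  | Relabel nat nat "'a cw_expr"

primrec cw_verts :: "'a cw_expr \<Rightarrow> 'a set" where
  "cw_verts (Vertex v i) = {v}"
| "cw_verts (Disj_Union s t) = cw_verts s \<union> cw_verts t"
| "cw_verts (Join i j t) = cw_verts t"
| "cw_verts (Relabel i j t) = cw_verts t"

text \<open>The labelling is only meaningful on the vertices of the expression.\<close>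

primrec cw_lab :: "'a cw_expr \<Rightarrow> 'a \<Rightarrow> nat" where
  "cw_lab (Vertex v i) = (\<lambda>_. i)"
| "cw_lab (Disj_Union s t) = (\<lambda>x. if x \<in> cw_verts s then cw_lab s x else cw_lab t x)"
| "cw_lab (Join i j t) = cw_lab t"
| "cw_lab (Relabel i j t) = (\<lambda>x. if cw_lab t x = i then j else cw_lab t x)"

primrec cw_arcs :: "'a cw_expr \<Rightarrow> ('a \<times> 'a) set" where
  "cw_arcs (Vertex v i) = {}"
| "cw_arcs (Disj_Union s t) = cw_arcs s \<union> cw_arcs t"
| "cw_arcs (Join i j t) = cw_arcs t \<union>
     {(u, v). u \<in> cw_verts t \<and> v \<in> cw_verts t \<and>
        (cw_lab t u = i \<and> cw_lab t v = j \<or> cw_lab t u = j \<and> cw_lab t v = i)}"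
| "cw_arcs (Relabel i j t) = cw_arcs t"

primrec cw_wf :: "'a cw_expr \<Rightarrow> bool" where
  "cw_wf (Vertex v i) \<longleftrightarrow> True"
| "cw_wf (Disj_Union s t) \<longleftrightarrow> cw_wf s \<and> cw_wf t \<and> cw_verts s \<inter> cw_verts t = {}"
| "cw_wf (Join i j t) \<longleftrightarrow> cw_wf t \<and> i \<noteq> j"
| "cw_wf (Relabel i j t) \<longleftrightarrow> cw_wf t"

primrec cw_labels :: "'a cw_expr \<Rightarrow> nat set" where
  "cw_labels (Vertex v i) = {i}"
| "cw_labels (Disj_Union s t) = cw_labels s \<union> cw_labels t"
| "cw_labels (Join i j t) = {i, j} \<union> cw_labels t"
| "cw_labels (Relabel i j t) = {i, j} \<union> cw_labels t"

definition cw_graph :: "'a cw_expr \<Rightarrow> 'a pair_pre_digraph" where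
  "cw_graph t = \<lparr> pverts = cw_verts t, parcs = cw_arcs t \<rparr>"

text \<open>
  The four operations only build nonempty graphs; the null graph, which \<^locale>\<open>pair_graph\<close>
  admits, gets clique-width \<open>0\<close>. For every other finite graph the minimum is attained
  (\<open>cw_expr_exists\<close> below).
\<close>

definition clique_width :: "'a pair_pre_digraph \<Rightarrow> nat" where
  "clique_width G = (if pverts G = {} then 0
     else LEAST k. \<exists>t. cw_wf t \<and> cw_graph t = G \<and> card (cw_labels t) = k)"

definition bounded_clique_width :: "'a pair_pre_digraph set \<Rightarrow> bool" where
  "bounded_clique_width \<G> \<longleftrightarrow> (\<exists>c. \<forall>G\<in>\<G>. clique_width G \<le> c)"

section \<open>Well-definedness\<close>

lemma finite_cw_verts: "finite (cw_verts t)"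
  by (induction t) auto

lemma finite_cw_labels: "finite (cw_labels t)"
  by (induction t) auto

lemma cw_arcs_subset: "cw_arcs t \<subseteq> cw_verts t \<times> cw_verts t"
  by (induction t) auto

lemma pair_graph_cw_graph:
  assumes "cw_wf t"
  shows "pair_graph (cw_graph t)"
proof -
  have sym: "sym (cw_arcs t)"
    by (induction t) (auto simp: sym_def)
  have irr: "(u, v) \<in> cw_arcs t \<Longrightarrow> u \<noteq> v" for u v
    using assms by (induction t) auto
  have fin: "finite (cw_arcs t)"
    by (rule finite_subset[OF cw_arcs_subset]) (simp add: finite_cw_verts)
  show ?thesis
  proof
    show "symmetric (with_proj (cw_graph t))"
      using sym by (simp add: cw_graph_def symmetric_def)
  qed (use irr fin cw_arcs_subset[of t] finite_cw_verts[of t] in \<open>auto simp: cw_graph_def\<close>)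
qed

lemma cw_edgeless_exists:
  fixes f :: "'a \<Rightarrow> nat"
  assumes "finite S" "S \<noteq> {}"
  shows "\<exists>t. cw_wf t \<and> cw_verts t = S \<and> cw_arcs t = {} \<and> (\<forall>x\<in>S. cw_lab t x = f x)"
  using assms
proof (induction S rule: finite_ne_induct)
  case (singleton x)
  show ?case by (rule exI[of _ "Vertex x (f x)"]) simp
next
  case (insert x S)
  then obtain t where "cw_wf t" "cw_verts t = S" "cw_arcs t = {}" "\<forall>x\<in>S. cw_lab t x = f x"
    by blast
  with insert show ?case
    by (intro exI[of _ "Disj_Union (Vertex x (f x)) t"]) auto
qed

lemma cw_expr_exists:
  assumes "pair_graph G" "pverts G \<noteq> {}"
  shows "\<exists>t. cw_wf t \<and> cw_graph t = G"
proof -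
  interpret pair_graph G by fact
  obtain f :: "'a \<Rightarrow> nat" where f: "inj_on f (pverts G)"
    using finite_imp_inj_to_nat_seg[OF pair_finite_verts] by blast
  have "\<exists>t. cw_wf t \<and> cw_verts t = pverts G \<and> cw_arcs t = F \<union> F\<inverse> \<and>
      (\<forall>x\<in>pverts G. cw_lab t x = f x)" if "F \<subseteq> parcs G" for F
    using finite_subset[OF that pair_finite_arcs] that
  proof (induction F rule: finite_induct)
    case empty
    show ?case using cw_edgeless_exists[OF pair_finite_verts assms(2), of f] by simp
  next
    case (insert e F)
    obtain u v where e: "e = (u, v)" by (cases e)
    from insert obtain t where t: "cw_wf t" "cw_verts t = pverts G" "cw_arcs t = F \<union> F\<inverse>"
      "\<forall>x\<in>pverts G. cw_lab t x = f x" by blast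
    have uv: "u \<in> pverts G" "v \<in> pverts G" "u \<noteq> v"
      using insert.prems e wellformed' no_loops' by auto
    then have "f u \<noteq> f v" using inj_on_eq_iff[OF f] by simp
    then have "cw_wf (Join (f u) (f v) t)" using t by simp
    moreover have "cw_arcs (Join (f u) (f v) t) = insert e F \<union> (insert e F)\<inverse>"
      using t uv e by (auto simp: inj_on_eq_iff[OF f])
    ultimately show ?case using t by (intro exI[of _ "Join (f u) (f v) t"]) simp
  qed
  from this[of "parcs G"] obtain t
    where t: "cw_wf t" "cw_verts t = pverts G" "cw_arcs t = parcs G \<union> (parcs G)\<inverse>" by blast
  then have "cw_arcs t = parcs G" using arcs_symmetric by auto
  with t show ?thesis by (auto simp: cw_graph_def)
qed

end

theory Submission
  imports Defs "HOL-Library.Countable"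
begin

text \<open>
  Take independent sets \<open>A 0, \<dots>, A (n - 1)\<close> and \<open>C 0, \<dots>, C (n - 1)\<close>, complete to one another, and
  for all \<open>i, j\<close> a vertex \<open>B i j\<close> adjacent to exactly \<open>A i\<close> and \<open>C j\<close>. Every edge lies in a single
  triangle, so there is no diamond; the two neighbours of a vertex \<open>B i j\<close> are adjacent, so such
  a vertex cannot be an inner vertex of an induced path, and four consecutive inner vertices would
  form an induced \<open>P\<^sub>4\<close> in a complete bipartite graph.

  The vertex set \<open>X\<close> of a subexpression of a \<open>k\<close>-expression splits into at most \<open>k\<close> classes of
  vertices with equal neighbourhoods outside \<open>X\<close>. Hence at most \<open>2k\<close> rows and \<open>2k\<close> columns of the
  grid \<open>B i j\<close> meet both \<open>X\<close> and its complement. If \<open>n > 2k\<close>, some column is pure, and so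
  \<open>X\<close> contains all grid vertices outside \<open>2k\<close> rows, or none. As a subexpression grows
  by disjoint unions only, it can never jump from the second case to the first when \<open>n > 6k\<close>.
\<close>

section \<open>Induced subgraphs as embeddings\<close>

text \<open>This replaces copies up to isomorphism by injections that preserve and reflect
  adjacency. The isomorphism leads from the subgraph \<open>K\<close> to \<open>H\<close>, so the
  embedding is the inverse of its vertex map.\<close>

lemma induced_freeI:
  assumes "\<And>f. inj_on f (pverts H) \<Longrightarrow> f ` pverts H \<subseteq> pverts G \<Longrightarrow>
      (\<And>u v. u \<in> pverts H \<Longrightarrow> v \<in> pverts H \<Longrightarrow> (f u, f v) \<in> parcs G \<longleftrightarrow> (u, v) \<in> parcs H) \<Longrightarrow> False"
  shows "induced_free H G"
  unfolding induced_free_def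
proof (rule notI, elim exE conjE)
  fix K
  assume ind: "induced_subgraph (with_proj K) (with_proj G)"
    and "digraph_iso (with_proj K) (with_proj H)"
  then obtain h where h: "pre_digraph.digraph_isomorphism (with_proj K) h"
    and H: "with_proj H = app_iso h (with_proj K)"
    by (auto simp: digraph_iso_def)
  let ?g = "iso_verts h"
  have inj: "inj_on ?g (pverts K)"
    using h by (simp add: pre_digraph.digraph_isomorphism_def)
  have vH: "pverts H = ?g ` pverts K"
    using arg_cong[OF H, of verts] by simp
  \<comment> \<open>Under \<open>with_proj\<close> an arc is the pair of its ends, so the arc map of
    an isomorphism is determined by its vertex map.\<close>
  have ends: "iso_arcs h (u, v) = (?g u, ?g v)" if "(u, v) \<in> parcs K" for u v
  proof -
    have "tail (with_proj H) (iso_arcs h (u, v)) = ?g u"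
      "head (with_proj H) (iso_arcs h (u, v)) = ?g v"
      using h that unfolding H by (auto simp: pre_digraph.digraph_isomorphism_def)
    then show ?thesis by (simp add: prod_eq_iff)
  qed
  have aH: "parcs H = iso_arcs h ` parcs K"
    using arg_cong[OF H, of arcs] by simp
  have wfK: "parcs K \<subseteq> pverts K \<times> pverts K"
    using h wf_digraph.wellformed[of "with_proj K"]
    by (fastforce simp: pre_digraph.digraph_isomorphism_def)
  have arcs: "(?g u, ?g v) \<in> parcs H \<longleftrightarrow> (u, v) \<in> parcs K" if "u \<in> pverts K" "v \<in> pverts K" for u v
    using that inj wfK ends unfolding aH by (force simp: inj_on_eq_iff image_iff)
  have KG: "pverts K \<subseteq> pverts G"
    "parcs K = {e \<in> parcs G. fst e \<in> pverts K \<and> snd e \<in> pverts K}"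
    using ind by (auto simp: induced_subgraph_def subgraph_def)
  let ?f = "inv_into (pverts K) ?g"
  have f: "?f u \<in> pverts K" "?g (?f u) = u" if "u \<in> pverts H" for u
    using that unfolding vH by (auto intro: inv_into_into f_inv_into_f)
  show False
  proof (rule assms[of ?f])
    show "inj_on ?f (pverts H)" unfolding vH by (rule inj_on_inv_into) simp
    show "?f ` pverts H \<subseteq> pverts G" using f KG(1) by blast
    show "(?f u, ?f v) \<in> parcs G \<longleftrightarrow> (u, v) \<in> parcs H" if "u \<in> pverts H" "v \<in> pverts H" for u v
      using arcs[of "?f u" "?f v"] f[OF that(1)] f[OF that(2)] KG(2) by auto
  qed
qed

section \<open>Cuts along a clique-width expression\<close>

primrec subexprs :: "'a cw_expr \<Rightarrow> 'a cw_expr set" where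
  "subexprs (Vertex v i) = {Vertex v i}"
| "subexprs (Disj_Union s t) = insert (Disj_Union s t) (subexprs s \<union> subexprs t)"
| "subexprs (Join i j t) = insert (Join i j t) (subexprs t)"
| "subexprs (Relabel i j t) = insert (Relabel i j t) (subexprs t)"

lemma subexprs_refl: "t \<in> subexprs t"
  by (cases t) auto

lemma cw_verts_subexprs: "s \<in> subexprs t \<Longrightarrow> cw_verts s \<subseteq> cw_verts t"
  by (induction t) auto

lemma cw_labels_subexprs: "s \<in> subexprs t \<Longrightarrow> cw_labels s \<subseteq> cw_labels t"
  by (induction t) auto

lemma cw_lab_in_labels: "x \<in> cw_verts t \<Longrightarrow> cw_lab t x \<in> cw_labels t"
  by (induction t) auto

text \<open>Relabelling acts on whole label classes, so vertices that once share a label are never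
  separated again.\<close>

lemma cw_lab_subexprs_eq:
  assumes "cw_wf t" "s \<in> subexprs t" "x \<in> cw_verts s" "y \<in> cw_verts s" "cw_lab s x = cw_lab s y"
  shows "cw_lab t x = cw_lab t y"
  using assms(1,2)
proof (induction t)
  case (Disj_Union t1 t2)
  then show ?case
    using assms(3-5) cw_verts_subexprs[of s t1] cw_verts_subexprs[of s t2] by auto
qed (use assms in auto)

text \<open>An arc leaving \<open>s\<close> can only come from a join above \<open>s\<close>. Joins
  see nothing but labels, and \<open>x\<close> and \<open>y\<close> still share theirs by
  \<open>cw_lab_subexprs_eq\<close>.\<close>

lemma cw_arcs_subexprs_twins:
  assumes "cw_wf t" "s \<in> subexprs t" "x \<in> cw_verts s" "y \<in> cw_verts s" "cw_lab s x = cw_lab s y"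
    and "z \<notin> cw_verts s"
  shows "(x, z) \<in> cw_arcs t \<longleftrightarrow> (y, z) \<in> cw_arcs t"
  using assms(1,2)
proof (induction t)
  case (Vertex v i)
  then show ?case by simp
next
  case (Disj_Union t1 t2)
  have away: "(w, z) \<notin> cw_arcs t'" if "w \<notin> cw_verts t'" for w t'
    using that cw_arcs_subset[of t'] by auto
  consider "s = Disj_Union t1 t2" | "s \<in> subexprs t1" | "s \<in> subexprs t2"
    using Disj_Union.prems by auto
  then show ?case
  proof cases
    case 1
    then show ?thesis using assms(6) cw_arcs_subset[of s] by auto
  next
    case 2
    then have "x \<notin> cw_verts t2" "y \<notin> cw_verts t2"
      using assms(3,4) Disj_Union.prems(1) cw_verts_subexprs[of s t1] by auto
    then show ?thesis using Disj_Union.IH(1)[OF _ 2] Disj_Union.prems(1) by (simp add: away)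
  next
    case 3
    then have "x \<notin> cw_verts t1" "y \<notin> cw_verts t1"
      using assms(3,4) Disj_Union.prems(1) cw_verts_subexprs[of s t2] by auto
    then show ?thesis using Disj_Union.IH(2)[OF _ 3] Disj_Union.prems(1) by (simp add: away)
  qed
next
  case (Join i j t)
  show ?case
  proof (cases "s = Join i j t")
    case True
    then show ?thesis using assms(6) cw_arcs_subset[of s] by blast
  next
    case False
    with Join.prems have s: "cw_wf t" "s \<in> subexprs t" by auto
    have "x \<in> cw_verts t" "y \<in> cw_verts t"
      using assms(3,4) cw_verts_subexprs[OF s(2)] by auto
    moreover have "cw_lab t x = cw_lab t y"
      by (rule cw_lab_subexprs_eq[OF s assms(3-5)])
    ultimately show ?thesis using Join.IH[OF s] by simp
  qed
next
  case (Relabel i j t)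
  then show ?case using assms(3-6) cw_arcs_subset[of t] by auto
qed

text \<open>Joins and relabellings keep the vertex set, a leaf contributes at most
  \<open>1 < M\<close>, and a union of two small parts at most \<open>2 * m < M\<close>. Hence no
  step crosses the gap between \<open>m\<close> and \<open>M\<close>.\<close>

lemma card_subexprs_gap:
  assumes "\<And>s. s \<in> subexprs t \<Longrightarrow> card (cw_verts s \<inter> S) \<le> m \<or> M \<le> card (cw_verts s \<inter> S)"
    and "2 * m < M" "1 < M"
  shows "card (cw_verts t \<inter> S) \<le> m"
  using assms(1)
proof (induction t)
  case (Vertex v i)
  have "card ({v} \<inter> S) \<le> 1"
    using card_mono[of "{v}" "{v} \<inter> S"] by simp
  then show ?case using Vertex[of "Vertex v i"] assms(3) by fastforce
next
  case (Disj_Union s t)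
  have "card (cw_verts s \<inter> S) \<le> m" "card (cw_verts t \<inter> S) \<le> m"
    using Disj_Union by auto
  moreover have "card (cw_verts (Disj_Union s t) \<inter> S)
      \<le> card (cw_verts s \<inter> S) + card (cw_verts t \<inter> S)"
    by (simp add: Int_Un_distrib2 card_Un_le)
  ultimately show ?case
    using Disj_Union.prems[OF subexprs_refl] assms(2) by linarith
qed auto

lemma clique_width_expr:
  assumes "pair_graph G" "pverts G \<noteq> {}"
  obtains t where "cw_wf t" "cw_graph t = G" "card (cw_labels t) = clique_width G"
proof -
  let ?P = "\<lambda>k. \<exists>t. cw_wf t \<and> cw_graph t = G \<and> card (cw_labels t) = k"
  have "\<exists>k. ?P k" using cw_expr_exists[OF assms] by blast
  then have "?P (LEAST k. ?P k)" by (rule LeastI_ex)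
  then show ?thesis using that assms(2) by (auto simp: clique_width_def)
qed

section \<open>Subsets of a grid with few mixed lines\<close>

text \<open>Since \<open>m < n\<close>, some column is pure. It meets every row, so any cell that
  disagrees with it lies in a mixed row, and the mixed rows hold at most \<open>m * n\<close>
  cells.\<close>

lemma grid_few_mixed_lines:
  fixes n m :: nat and P :: "nat \<Rightarrow> nat \<Rightarrow> bool"
  assumes rows: "card {i. i < n \<and> (\<exists>j<n. P i j) \<and> (\<exists>j<n. \<not> P i j)} \<le> m" (is "card ?R \<le> m")
    and cols: "card {j. j < n \<and> (\<exists>i<n. P i j) \<and> (\<exists>i<n. \<not> P i j)} \<le> m" (is "card ?C \<le> m")
    and "m < n"
  shows "card {(i, j). i < n \<and> j < n \<and> P i j} \<le> m * n \<or>
    n * n - m * n \<le> card {(i, j). i < n \<and> j < n \<and> P i j}"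
proof -
  let ?D = "{(i, j). i < n \<and> j < n \<and> P i j}"
  let ?N = "{..<n} \<times> {..<n}"
  have "\<not> {..<n} \<subseteq> ?C"
    using card_mono[of ?C "{..<n}"] cols \<open>m < n\<close> by auto
  then obtain j where j: "j < n" "j \<notin> ?C" by auto
  have strip: "card E \<le> m * n" if "E \<subseteq> ?R \<times> {..<n}" for E
  proof -
    have "card E \<le> card (?R \<times> {..<n})" using that by (intro card_mono) auto
    also have "\<dots> \<le> m * n" using rows by (simp add: card_cartesian_product)
    finally show ?thesis .
  qed
  consider "\<forall>i<n. P i j" | "\<forall>i<n. \<not> P i j" using j by auto
  then show ?thesis
  proof cases
    case 1
    have "card (?N - ?D) \<le> m * n" by (rule strip) (use 1 j in auto)
    moreover have "card (?N - ?D) = n * n - card ?D"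
      by (subst card_Diff_subset) (auto intro: finite_subset[of _ ?N])
    ultimately show ?thesis by linarith
  next
    case 2
    have "card ?D \<le> m * n" by (rule strip) (use 2 j in auto)
    then show ?thesis ..
  qed
qed

section \<open>The graphs\<close>

datatype vertex = A nat | C nat | B nat nat

instance vertex :: countable
  by countable_datatype

fun adj :: "vertex \<Rightarrow> vertex \<Rightarrow> bool" where
  "adj (A i) (C j) \<longleftrightarrow> True"
| "adj (C j) (A i) \<longleftrightarrow> True"
| "adj (A i) (B i' j) \<longleftrightarrow> i = i'"
| "adj (B i' j) (A i) \<longleftrightarrow> i = i'"
| "adj (C j) (B i j') \<longleftrightarrow> j = j'"
| "adj (B i j') (C j) \<longleftrightarrow> j = j'"
| "adj _ _ \<longleftrightarrow> False"

lemma adj_sym: "adj u v \<longleftrightarrow> adj v u"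
  by (cases u; cases v) auto

lemma adj_irrefl: "\<not> adj u u"
  by (cases u) auto

text \<open>Every triangle consists of \<open>A i\<close>, \<open>C j\<close> and
  \<open>B i j\<close>, and any two of these determine both indices.\<close>

lemma adj_common_nbr_unique: "adj x y \<Longrightarrow> adj x p \<Longrightarrow> adj y p \<Longrightarrow> adj x q \<Longrightarrow> adj y q \<Longrightarrow> p = q"
  by (cases x; cases y; cases p; cases q) auto

lemma adj_nbrs_of_B: "adj u (B i j) \<Longrightarrow> adj (B i j) v \<Longrightarrow> u \<noteq> v \<Longrightarrow> adj u v"
  by (cases u; cases v) auto

text \<open>Without the \<open>B\<close> vertices the graph is complete bipartite, and a walk of
  three edges ends on the side opposite to its start.\<close>

lemma adj_path4_outside_B:
  "adj p q \<Longrightarrow> adj q r \<Longrightarrow> adj r s \<Longrightarrow> p \<notin> range (case_prod B) \<Longrightarrow> q \<notin> range (case_prod B) \<Longrightarrow>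
   r \<notin> range (case_prod B) \<Longrightarrow> s \<notin> range (case_prod B) \<Longrightarrow> adj p s"
  by (cases p; cases q; cases r; cases s) auto

definition vertices :: "nat \<Rightarrow> vertex set" where
  "vertices n = A ` {..<n} \<union> C ` {..<n} \<union> case_prod B ` ({..<n} \<times> {..<n})"

text \<open>The encoding \<open>to_nat\<close> is there because the class in the theorem consists of
  graphs on natural numbers.\<close>

definition grid_graph :: "nat \<Rightarrow> nat pair_pre_digraph" where
  "grid_graph n = \<lparr> pverts = to_nat ` vertices n,
     parcs = {(to_nat u, to_nat v) |u v. u \<in> vertices n \<and> v \<in> vertices n \<and> adj u v} \<rparr>"

lemma finite_vertices: "finite (vertices n)"
  by (simp add: vertices_def)

lemma vertices_iff [simp]:
  "A i \<in> vertices n \<longleftrightarrow> i < n" "C j \<in> vertices n \<longleftrightarrow> j < n" "B i j \<in> vertices n \<longleftrightarrow> i < n \<and> j < n"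
  by (auto simp: vertices_def)

lemma parcs_grid_graph_iff:
  assumes "u \<in> vertices n" "v \<in> vertices n"
  shows "(to_nat u, to_nat v) \<in> parcs (grid_graph n) \<longleftrightarrow> adj u v"
  using assms by (auto simp: grid_graph_def)

lemma pair_graph_grid_graph: "pair_graph (grid_graph n)"
proof
  show "finite (parcs (grid_graph n))"
    by (rule finite_subset[of _ "to_nat ` vertices n \<times> to_nat ` vertices n"])
      (auto simp: grid_graph_def finite_vertices)
  show "symmetric (with_proj (grid_graph n))"
    by (auto simp: symmetric_def sym_def grid_graph_def adj_sym)
qed (auto simp: grid_graph_def finite_vertices adj_irrefl)

lemma induced_free_grid_graphI:
  assumes "\<And>g. inj_on g (pverts H) \<Longrightarrow>
      (\<And>u v. u \<in> pverts H \<Longrightarrow> v \<in> pverts H \<Longrightarrow> adj (g u) (g v) \<longleftrightarrow> (u, v) \<in> parcs H) \<Longrightarrow> False"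
  shows "induced_free H (grid_graph n)"
proof (rule induced_freeI)
  fix f
  assume inj: "inj_on f (pverts H)" and sub: "f ` pverts H \<subseteq> pverts (grid_graph n)"
    and arcs: "\<And>u v. u \<in> pverts H \<Longrightarrow> v \<in> pverts H \<Longrightarrow>
      (f u, f v) \<in> parcs (grid_graph n) \<longleftrightarrow> (u, v) \<in> parcs H"
  define g :: "'a \<Rightarrow> vertex" where "g = from_nat \<circ> f"
  have g: "g u \<in> vertices n" "f u = to_nat (g u)" if "u \<in> pverts H" for u
    using sub that by (auto simp: g_def grid_graph_def)
  show False
  proof (rule assms)
    show "inj_on g (pverts H)" using inj g(2) by (auto simp: inj_on_def)
    show "adj (g u) (g v) \<longleftrightarrow> (u, v) \<in> parcs H" if "u \<in> pverts H" "v \<in> pverts H" for u v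
      using arcs[OF that] g[OF that(1)] g[OF that(2)] by (simp add: parcs_grid_graph_iff)
  qed
qed

lemma induced_free_P6_grid_graph: "induced_free P\<^bsub>6\<^esub> (grid_graph n)"
proof (rule induced_free_grid_graphI)
  fix g :: "nat \<Rightarrow> vertex"
  assume inj: "inj_on g (pverts P\<^bsub>6\<^esub>)"
    and g: "\<And>u v. u \<in> pverts P\<^bsub>6\<^esub> \<Longrightarrow> v \<in> pverts P\<^bsub>6\<^esub> \<Longrightarrow> adj (g u) (g v) \<longleftrightarrow> (u, v) \<in> parcs P\<^bsub>6\<^esub>"
  have adj: "adj (g u) (g v) \<longleftrightarrow> v = Suc u \<or> u = Suc v" if "u < 6" "v < 6" for u v
    using g[of u v] that by (simp add: path_graph_def)
  have inner: "g (Suc u) \<notin> range (case_prod B)" if "u < 4" for u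
  proof
    assume "g (Suc u) \<in> range (case_prod B)"
    moreover have "g u \<noteq> g (Suc (Suc u))"
      using inj that by (auto simp: path_graph_def inj_on_eq_iff)
    ultimately have "adj (g u) (g (Suc (Suc u)))"
      using adj[of u "Suc u"] adj[of "Suc u" "Suc (Suc u)"] that by (auto intro: adj_nbrs_of_B)
    then show False using adj[of u "Suc (Suc u)"] that by simp
  qed
  \<comment> \<open>The inner vertices 1 to 4 avoid the \<open>B\<close> vertices, so the path
    between them closes to a 4-cycle.\<close>
  have "adj (g 1) (g 4)"
    by (rule adj_path4_outside_B[of _ "g 2" "g 3"])
      (use adj inner[of 0] inner[of 1] inner[of 2] inner[of 3] in \<open>auto simp: numeral_eq_Suc\<close>)
  then show False using adj[of 1 4] by simp
qed

lemma induced_free_diamond_grid_graph: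
  "induced_free (complement_graph (2 \<cdot>\<^sub>G P\<^bsub>1\<^esub> \<oplus>\<^sub>G P\<^bsub>2\<^esub>)) (grid_graph n)"
proof (rule induced_free_grid_graphI)
  let ?D = "complement_graph (2 \<cdot>\<^sub>G P\<^bsub>1\<^esub> \<oplus>\<^sub>G P\<^bsub>2\<^esub>)"
  fix g :: "nat \<times> nat + nat \<Rightarrow> vertex"
  assume inj: "inj_on g (pverts ?D)"
    and g: "\<And>u v. u \<in> pverts ?D \<Longrightarrow> v \<in> pverts ?D \<Longrightarrow> adj (g u) (g v) \<longleftrightarrow> (u, v) \<in> parcs ?D"
  note defs = complement_graph_def disjoint_sum_def graph_copies_def path_graph_def
  have V: "Inl (0, 0) \<in> pverts ?D" "Inl (1, 0) \<in> pverts ?D" "Inr 0 \<in> pverts ?D" "Inr 1 \<in> pverts ?D"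
    by (auto simp: defs)
  have "g (Inr 0) = g (Inr 1)"
    by (rule adj_common_nbr_unique[of "g (Inl (0, 0))" "g (Inl (1, 0))"])
      (simp_all only: g V, simp_all add: defs InlI InrI)
  then show False using inj V by (simp add: inj_on_eq_iff)
qed

section \<open>Lower bound on the clique-width\<close>

text \<open>The vertex \<open>p i\<close> sees line \<open>i\<close> only. If \<open>p i\<close>
  lies outside \<open>X\<close>, it separates a representative of its line in \<open>X\<close> from
  those of other lines; if it lies inside, a missing vertex of its line separates it from every
  other \<open>p i'\<close>. Either way labels are distinct, giving at most \<open>k\<close> lines
  of each kind. Abstract \<open>p\<close> and \<open>q\<close> let rows and columns share the
  argument.\<close>

lemma card_mixed_lines_le:
  fixes X :: "vertex set" and lab :: "vertex \<Rightarrow> nat"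
  assumes twins: "\<And>x y z. x \<in> X \<Longrightarrow> y \<in> X \<Longrightarrow> lab x = lab y \<Longrightarrow> z \<in> vertices n \<Longrightarrow> z \<notin> X \<Longrightarrow>
      adj x z \<longleftrightarrow> adj y z"
    and lab: "lab ` X \<subseteq> L" "finite L" "card L \<le> k"
    and pq: "\<And>i. i < n \<Longrightarrow> p i \<in> vertices n"
      "\<And>i j. i < n \<Longrightarrow> j < n \<Longrightarrow> q i j \<in> vertices n"
      "\<And>i i' j. adj (p i) (q i' j) \<longleftrightarrow> i = i'"
  shows "card {i. i < n \<and> (\<exists>j<n. q i j \<in> X) \<and> (\<exists>j<n. q i j \<notin> X)} \<le> 2 * k" (is "card ?M \<le> _")
proof -
  have qp: "adj (q i' j) (p i) \<longleftrightarrow> i = i'" for i i' j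
    using pq(3) adj_sym by blast
  have le: "card S \<le> k" if "h ` S \<subseteq> X" "inj_on (lab \<circ> h) S" for h :: "nat \<Rightarrow> vertex" and S
    using card_inj_on_le[of "lab \<circ> h" S L] that lab by fastforce
  let ?S = "{i. i < n \<and> p i \<notin> X \<and> (\<exists>j<n. q i j \<in> X)}"
  let ?T = "{i. i < n \<and> p i \<in> X \<and> (\<exists>j<n. q i j \<notin> X)}"
  define c where "c i = (SOME j. j < n \<and> q i j \<in> X)" for i
  have c: "c i < n" "q i (c i) \<in> X" if "i \<in> ?S" for i
    using that someI_ex[of "\<lambda>j. j < n \<and> q i j \<in> X"] by (auto simp: c_def)
  have "card ?S \<le> k"
  proof (rule le)
    show "(\<lambda>i. q i (c i)) ` ?S \<subseteq> X" using c by blast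
    show "inj_on (lab \<circ> (\<lambda>i. q i (c i))) ?S"
    proof (rule inj_onI)
      fix i i' assume *: "i \<in> ?S" "i' \<in> ?S" "(lab \<circ> (\<lambda>i. q i (c i))) i = (lab \<circ> (\<lambda>i. q i (c i))) i'"
      then show "i = i'"
        using twins[OF c(2)[OF *(1)] c(2)[OF *(2)], of "p i"] pq(1) by (simp add: qp)
    qed
  qed
  moreover have "card ?T \<le> k"
  proof (rule le)
    show "p ` ?T \<subseteq> X" by blast
    show "inj_on (lab \<circ> p) ?T"
    proof (rule inj_onI)
      fix i i' assume *: "i \<in> ?T" "i' \<in> ?T" "(lab \<circ> p) i = (lab \<circ> p) i'"
      then obtain j where "j < n" "q i j \<notin> X" by blast
      then show "i = i'"
        using * twins[of "p i" "p i'" "q i j"] pq(2) by (simp add: pq(3))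
    qed
  qed
  moreover have "card ?M \<le> card (?S \<union> ?T)" by (rule card_mono) auto
  ultimately show ?thesis using card_Un_le[of ?S ?T] by linarith
qed

lemma clique_width_grid_graph:
  assumes "6 * k < n" "1 < n"
  shows "k < clique_width (grid_graph n)"
proof (rule ccontr)
  assume "\<not> k < clique_width (grid_graph n)"
  moreover have "A 0 \<in> vertices n" using assms by simp
  then have "pverts (grid_graph n) \<noteq> {}"
    unfolding grid_graph_def by (metis empty_iff image_is_empty pair_pre_digraph.select_convs(1))
  ultimately obtain t where t: "cw_wf t" "cw_graph t = grid_graph n" "card (cw_labels t) \<le> k"
    using clique_width_expr[OF pair_graph_grid_graph] by (metis not_less)
  have verts_t: "cw_verts t = to_nat ` vertices n" and arcs_t: "cw_arcs t = parcs (grid_graph n)"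
    using t(2) by (auto simp: cw_graph_def grid_graph_def)
  define b where "b = (\<lambda>(i, j). to_nat (B i j))"
  define S where "S = b ` ({..<n} \<times> {..<n})"
  have inj_b: "inj b" by (auto simp: b_def inj_on_def)
  have "card (cw_verts t \<inter> S) \<le> 2 * k * n"
  proof (rule card_subexprs_gap)
    fix s assume s: "s \<in> subexprs t"
    define X where "X = to_nat -` cw_verts s \<inter> vertices n"
    have X_iff: "x \<in> X \<longleftrightarrow> to_nat x \<in> cw_verts s" if "x \<in> vertices n" for x
      using that by (auto simp: X_def)
    have twins: "adj x z \<longleftrightarrow> adj y z"
      if "x \<in> X" "y \<in> X" "cw_lab s (to_nat x) = cw_lab s (to_nat y)" "z \<in> vertices n" "z \<notin> X"
      for x y z
      using cw_arcs_subexprs_twins[OF t(1) s, of "to_nat x" "to_nat y" "to_nat z"] that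
      by (auto simp: arcs_t parcs_grid_graph_iff X_def)
    \<comment> \<open>Taking the labels of all of \<open>t\<close> gives one bound \<open>k\<close>
      for every subexpression.\<close>
    have labs: "(\<lambda>x. cw_lab s (to_nat x)) ` X \<subseteq> cw_labels t"
      using cw_lab_in_labels[of _ s] cw_labels_subexprs[OF s] by (auto simp: X_def)
    have "card {i. i < n \<and> (\<exists>j<n. B i j \<in> X) \<and> (\<exists>j<n. B i j \<notin> X)} \<le> 2 * k"
      by (rule card_mixed_lines_le[OF twins labs finite_cw_labels t(3), where p = A]) auto
    moreover have "card {j. j < n \<and> (\<exists>i<n. B i j \<in> X) \<and> (\<exists>i<n. B i j \<notin> X)} \<le> 2 * k"
      by (rule card_mixed_lines_le[OF twins labs finite_cw_labels t(3),
            where p = C and q = "\<lambda>j i. B i j"]) auto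
    ultimately have "card {(i, j). i < n \<and> j < n \<and> B i j \<in> X} \<le> 2 * k * n \<or>
        n * n - 2 * k * n \<le> card {(i, j). i < n \<and> j < n \<and> B i j \<in> X}"
      using assms by (intro grid_few_mixed_lines) auto
    moreover have "cw_verts s \<inter> S = b ` {(i, j). i < n \<and> j < n \<and> B i j \<in> X}"
      by (auto simp: S_def b_def X_iff)
    ultimately show "card (cw_verts s \<inter> S) \<le> 2 * k * n \<or> n * n - 2 * k * n \<le> card (cw_verts s \<inter> S)"
      using card_image[OF inj_on_subset[OF inj_b subset_UNIV]] by simp
  next
    \<comment> \<open>From \<open>6 * k < n\<close> follows
      \<open>4 * k + 1 \<le> n - 2 * k\<close>, which makes the upper threshold exceed twice the
      lower one.\<close>
    have "n * n - 2 * k * n = (n - 2 * k) * n" by (simp add: diff_mult_distrib)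
    moreover have "(4 * k + 1) * n \<le> (n - 2 * k) * n" using assms by (intro mult_right_mono) auto
    ultimately have "4 * k * n + n \<le> n * n - 2 * k * n" by (simp add: algebra_simps)
    then show "2 * (2 * k * n) < n * n - 2 * k * n" "1 < n * n - 2 * k * n"
      using assms by linarith+
  qed
  \<comment> \<open>The whole expression contains all \<open>n * n\<close> grid vertices, more than
    the \<open>2 * k * n\<close> just allowed.\<close>
  moreover have "S \<subseteq> cw_verts t" by (auto simp: verts_t S_def b_def)
  then have "card (cw_verts t \<inter> S) = n * n"
    using card_image[OF inj_on_subset[OF inj_b subset_UNIV], of "{..<n} \<times> {..<n}"]
    by (simp add: Int_absorb1 S_def)
  ultimately show False using assms by simp
qed

theorem theorem4:
  shows "\<not> bounded_clique_width
    {G :: nat pair_pre_digraph. pair_graph G \<and>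
       induced_free P\<^bsub>6\<^esub> G \<and>
       induced_free (complement_graph (2 \<cdot>\<^sub>G P\<^bsub>1\<^esub> \<oplus>\<^sub>G P\<^bsub>2\<^esub>)) G}"
proof
  assume "bounded_clique_width {G :: nat pair_pre_digraph. pair_graph G \<and>
       induced_free P\<^bsub>6\<^esub> G \<and> induced_free (complement_graph (2 \<cdot>\<^sub>G P\<^bsub>1\<^esub> \<oplus>\<^sub>G P\<^bsub>2\<^esub>)) G}"
  then obtain c where c: "clique_width (grid_graph n) \<le> c" for n
    unfolding bounded_clique_width_def
    using pair_graph_grid_graph induced_free_P6_grid_graph induced_free_diamond_grid_graph by blast
  \<comment> \<open>The summand 2 instead of 1 secures \<open>1 < n\<close> also for
    \<open>c = 0\<close>.\<close>
  have "c < clique_width (grid_graph (6 * c + 2))"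
    by (rule clique_width_grid_graph) simp_all
  then show False using c leD by blast
qed

end
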